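(* For each integer $N\ge 2$, let $W_N^*$ be the $\pi(N)\times\pi(N)$ real symmetric matrix with entries $W_N^*[i,j]=\lfloor N/\operatorname{lcm}(p_i,p_j)\rfloor$, indexed by the primes $p_1<p_2<\cdots<p_{\pi(N)}\le N$. Then $$\frac{\lambda_{\max}(W_N^* )}{N}\longrightarrow\lambda_\infty\quad\text{as }N\to\infty.$$
   Context: $\pi(N)$ is the number of primes not exceeding $N$, and $\lambda_{\max}$ denotes the largest eigenvalue of a real symmetric matrix. The constant $\lambda_\infty$ is the unique solution $x\in\bigl(\tfrac14,+\infty\bigr)$ of $\sum_{p\text{ prime}}\frac{1}{xp^2-p+1}=1$. *)

theory Defs
  imports
    "Jordan_Normal_Form.Spectral_Radius"
    "HOL-Analysis.Infinite_Sum"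
    "HOL-Computational_Algebra.Primes"
begin

definition primes_le :: "nat \<Rightarrow> nat list" where
  "primes_le N = sorted_list_of_set {p. prime p \<and> p \<le> N}"

definition prime_count :: "nat \<Rightarrow> nat" where
  "prime_count N = card {p :: nat. prime p \<and> p \<le> N}"

text \<open>Indices start at \<open>0\<close>, so the prime \<open>p\<^sub>k\<close> is \<open>primes_le N ! (k - 1)\<close>.\<close>

definition W_star :: "nat \<Rightarrow> real mat" where
  "W_star N = mat (prime_count N) (prime_count N)
     (\<lambda>(i, j). real_of_int \<lfloor>real N / real (lcm (primes_le N ! i) (primes_le N ! j))\<rfloor>)"

text \<open>Meaningful only if the spectrum is nonempty, as it is for a real symmetric matrix
  of positive dimension; in particular \<open>lambda_max (W_star N)\<close> is unspecified for \<open>N < 2\<close>.\<close>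

definition lambda_max :: "real mat \<Rightarrow> real" where
  "lambda_max A = Max (spectrum A)"

definition lambda_inf :: real where
  "lambda_inf = (THE x. 1 / 4 < x \<and>
     ((\<lambda>p. 1 / (x * (real p)\<^sup>2 - real p + 1)) has_sum 1) {p. prime p})"

end

theory Submission
  imports
    "HOL-Analysis.Convex"
    "HOL-Analysis.Uniform_Limit"
    Defs
begin

text \<open>Divided by \<open>N\<close>, the entries of the matrix are at most \<open>1 / lcm p q\<close> and tend to it.
  Since distinct primes are coprime, the limiting quadratic form is a diagonal form with
  coefficients \<open>1 / p - 1 / p\<^sup>2 \<le> 1 / 4\<close> plus the rank one form \<open>(\<Sum> f p / p)\<^sup>2\<close>
  (\<open>lcm_form_eq\<close>).  An eigenvalue \<open>x > 1 / 4\<close> of such an operator has the eigenvector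
  \<open>f p = p / (x p\<^sup>2 - p + 1)\<close>, and consistency of the rank one part is the equation
  \<open>\<Sum> 1 / (x p\<^sup>2 - p + 1) = 1\<close> that defines \<open>lambda_inf\<close>.  The proof
  uses only quadratic forms of finite matrices and never the operator on the sequence space.

  For the upper bound, a weighted Cauchy--Schwarz inequality shows that \<open>lambda_inf\<close> bounds the
  limiting form on vectors of norm \<open>1\<close> (\<open>lcm_form_le\<close>).  All entries are nonnegative, so after
  passing to absolute values rounding down only decreases the form; hence
  \<open>lambda_max (W_star N) \<le> N * lambda_inf\<close> without any error term.

  For the lower bound, the eigenvector above is cut off to a finite set \<open>F\<close> of primes.  For fixed
  \<open>F\<close> its Rayleigh quotient for \<open>W_star N / N\<close> converges as \<open>N\<close> grows, and the limit differs from
  \<open>lambda_inf\<close> by at most a constant multiple of the tail of the convergent sum over primes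
  (\<open>lcm_form_truncated_eigenvector\<close>).

  Turning Rayleigh quotients into eigenvalues needs the fact that a real symmetric matrix has a
  real eigenvalue at least as large as any of its Rayleigh quotients
  (\<open>symmetric_eigenvalue_ge_rayleigh\<close>); it also makes the maximum over the spectrum
  meaningful.\<close>

unbundle no vec_syntax
unbundle no inner_syntax

section \<open>Eigenvalues above a Rayleigh quotient\<close>

lemma scalar_prod_mult_mat_vec_sum:
  fixes A :: "real mat"
  assumes "A \<in> carrier_mat n n" "u \<in> carrier_vec n"
  shows "u \<bullet> (A *\<^sub>v u) = (\<Sum>i<n. \<Sum>j<n. u $ i * A $$ (i, j) * u $ j)"
proof -
  have "u \<bullet> (A *\<^sub>v u) = (\<Sum>i<n. u $ i * (\<Sum>j<n. A $$ (i, j) * u $ j))"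
    using assms by (auto simp: scalar_prod_def atLeast0LessThan intro!: sum.cong)
  thus ?thesis
    by (simp add: sum_distrib_left mult.assoc)
qed

lemma scalar_prod_self_sum:
  fixes u :: "real vec"
  assumes "u \<in> carrier_vec n"
  shows "u \<bullet> u = (\<Sum>i<n. (u $ i)\<^sup>2)"
  using assms by (auto simp: scalar_prod_def atLeast0LessThan power2_eq_square)

lemma scalar_prod_self_pos:
  fixes u :: "real vec"
  assumes "u \<in> carrier_vec n" "u \<noteq> 0\<^sub>v n"
  shows "u \<bullet> u > 0"
proof -
  obtain i where i: "i < n" "u $ i \<noteq> 0"
    using assms by (metis carrier_vecD eq_vecI index_zero_vec)
  have "(u $ i)\<^sup>2 \<le> (\<Sum>i<n. (u $ i)\<^sup>2)"
    using i by (intro member_le_sum) auto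
  thus ?thesis
    using i scalar_prod_self_sum[OF assms(1)] by (smt (verit) zero_less_power2)
qed

lemma abs_quadratic_form_le_entry_sum:
  fixes A :: "real mat"
  assumes A: "A \<in> carrier_mat n n" and u: "u \<in> carrier_vec n"
  shows "\<bar>u \<bullet> (A *\<^sub>v u)\<bar> \<le> (\<Sum>i<n. \<Sum>j<n. \<bar>A $$ (i, j)\<bar>) * (u \<bullet> u)"
proof -
  have "\<bar>u $ i * A $$ (i, j) * u $ j\<bar> \<le> \<bar>A $$ (i, j)\<bar> * (u \<bullet> u)" if "i < n" "j < n" for i j
  proof -
    have sq: "(u $ k)\<^sup>2 \<le> u \<bullet> u" if "k < n" for k
      unfolding scalar_prod_self_sum[OF u] using that by (intro member_le_sum) auto
    have "\<bar>u $ i * u $ j\<bar> \<le> ((u $ i)\<^sup>2 + (u $ j)\<^sup>2) / 2"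
      using sum_squares_bound[of "\<bar>u $ i\<bar>" "\<bar>u $ j\<bar>"] by (simp add: abs_mult)
    also have "\<dots> \<le> u \<bullet> u"
      using sq[OF that(1)] sq[OF that(2)] by simp
    finally have "\<bar>A $$ (i, j)\<bar> * \<bar>u $ i * u $ j\<bar> \<le> \<bar>A $$ (i, j)\<bar> * (u \<bullet> u)"
      by (rule mult_left_mono) simp
    thus ?thesis by (simp add: abs_mult mult_ac)
  qed
  thus ?thesis
    unfolding scalar_prod_mult_mat_vec_sum[OF A u] sum_distrib_right
    by (intro order_trans[OF sum_abs] sum_mono) auto
qed

lemma symmetric_form_commute:
  fixes A :: "real mat"
  assumes A: "A \<in> carrier_mat n n" "transpose_mat A = A"
    and "u \<in> carrier_vec n" "v \<in> carrier_vec n"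
  shows "v \<bullet> (A *\<^sub>v u) = u \<bullet> (A *\<^sub>v v)"
  using transpose_vec_mult_scalar[OF A(1) assms(3,4)] A assms(3,4)
  by (metis comm_scalar_prod mult_mat_vec_carrier)

text \<open>Let \<open>B\<close> be the inverse of \<open>K\<close>.  Expanding the form at \<open>u + t B u\<close> gives
  \<open>u \<bullet> K u + 2 t (u \<bullet> u) + t\<^sup>2 (u \<bullet> B u) \<le> 0\<close>, and for small \<open>t > 0\<close> the linear term
  dominates, because \<open>\<bar>u \<bullet> B u\<bar>\<close> is at most a constant times \<open>u \<bullet> u\<close>.\<close>
lemma negative_semidefinite_invertible_imp_definite:
  fixes K :: "real mat"
  assumes K: "K \<in> carrier_mat n n" "transpose_mat K = K" "det K \<noteq> 0"
    and nonpos: "\<And>u. u \<in> carrier_vec n \<Longrightarrow> u \<bullet> (K *\<^sub>v u) \<le> 0"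
  obtains d where "d > 0" "\<And>u. u \<in> carrier_vec n \<Longrightarrow> u \<bullet> (K *\<^sub>v u) \<le> - d * (u \<bullet> u)"
proof -
  obtain B where B: "B \<in> carrier_mat n n" "K * B = 1\<^sub>m n"
    using det_non_zero_imp_unit[OF K(1,3), of "()"]
    unfolding Units_def by (auto simp: ring_mat_def)
  define C where "C = 1 + (\<Sum>i<n. \<Sum>j<n. \<bar>B $$ (i, j)\<bar>)"
  have C: "C > 0"
    unfolding C_def by (intro add_pos_nonneg sum_nonneg) auto
  have "u \<bullet> (K *\<^sub>v u) \<le> - (1 / C) * (u \<bullet> u)" if u: "u \<in> carrier_vec n" for u
  proof -
    define v where "v = B *\<^sub>v u"
    define t where "t = 1 / C"
    have v: "v \<in> carrier_vec n" and Ku: "K *\<^sub>v u \<in> carrier_vec n"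
      using B u K by (auto simp: v_def)
    have Kv: "K *\<^sub>v v = u"
      using B u K by (simp add: v_def assoc_mult_mat_vec[symmetric])
    have "- (u \<bullet> v) \<le> (\<Sum>i<n. \<Sum>j<n. \<bar>B $$ (i, j)\<bar>) * (u \<bullet> u)"
      unfolding v_def using abs_quadratic_form_le_entry_sum[OF B(1) u] by linarith
    also have "\<dots> \<le> C * (u \<bullet> u)"
      unfolding C_def using scalar_prod_self_sum[OF u] by (intro mult_right_mono) (auto intro: sum_nonneg)
    finally have uv: "- (u \<bullet> v) \<le> C * (u \<bullet> u)" .
    have "0 \<ge> (u + t \<cdot>\<^sub>v v) \<bullet> (K *\<^sub>v (u + t \<cdot>\<^sub>v v))"
      using u v by (intro nonpos) auto
    also have "K *\<^sub>v (u + t \<cdot>\<^sub>v v) = K *\<^sub>v u + t \<cdot>\<^sub>v u"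
      using K u v Kv by (simp add: mult_add_distrib_mat_vec[of _ n n] mult_mat_vec[of _ n n])
    also have "(u + t \<cdot>\<^sub>v v) \<bullet> \<dots> = u \<bullet> (K *\<^sub>v u) + t * (u \<bullet> u)
        + t * (v \<bullet> (K *\<^sub>v u)) + t * t * (v \<bullet> u)"
      using u v Ku by (simp add: add_scalar_prod_distrib[of _ n] scalar_prod_add_distrib[of _ n] algebra_simps)
    also have "v \<bullet> (K *\<^sub>v u) = u \<bullet> u"
      using symmetric_form_commute[OF K(1,2) u v] Kv by simp
    also have "v \<bullet> u = u \<bullet> v"
      by (rule comm_scalar_prod[OF v u])
    finally have "u \<bullet> (K *\<^sub>v u) \<le> - 2 * t * (u \<bullet> u) + t * t * (- (u \<bullet> v))"
      by (simp add: algebra_simps)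
    also have "\<dots> \<le> - 2 * t * (u \<bullet> u) + t * t * (C * (u \<bullet> u))"
      using uv by (intro add_left_mono mult_left_mono) auto
    also have "\<dots> = - t * (u \<bullet> u)"
      using C by (simp add: t_def field_simps)
    finally show ?thesis
      by (simp add: t_def)
  qed
  with C show ?thesis
    by (intro that[of "1 / C"]) auto
qed

text \<open>The least upper bound \<open>s\<close> of the Rayleigh quotients is an eigenvalue: otherwise \<open>A - s I\<close> is
  invertible and negative semidefinite, hence uniformly negative definite, so a number below \<open>s\<close>
  would still bound all quotients.\<close>
lemma symmetric_eigenvalue_ge_rayleigh:
  fixes A :: "real mat"
  assumes A: "A \<in> carrier_mat n n" "transpose_mat A = A"
    and w: "w \<in> carrier_vec n" "w \<noteq> 0\<^sub>v n"
  obtains e where "eigenvalue A e" "w \<bullet> (A *\<^sub>v w) \<le> e * (w \<bullet> w)"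
proof -
  define R where "R = {c. \<forall>u\<in>carrier_vec n. u \<bullet> (A *\<^sub>v u) \<le> c * (u \<bullet> u)}"
  define s where "s = Inf R"
  have ne: "R \<noteq> {}"
    unfolding R_def using abs_quadratic_form_le_entry_sum[OF A(1)] by (blast intro: abs_le_D1)
  have lower: "u \<bullet> (A *\<^sub>v u) / (u \<bullet> u) \<le> c"
    if "c \<in> R" "u \<in> carrier_vec n" "u \<noteq> 0\<^sub>v n" for c u
    using that scalar_prod_self_pos[of u n] by (auto simp: R_def field_simps)
  have bdd: "bdd_below R"
    using lower w by (intro bdd_belowI)
  have s: "u \<bullet> (A *\<^sub>v u) \<le> s * (u \<bullet> u)" if u: "u \<in> carrier_vec n" for u
  proof (cases "u = 0\<^sub>v n")
    case True
    moreover have "A *\<^sub>v u \<in> carrier_vec n"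
      using A u by simp
    ultimately show ?thesis by simp
  next
    case False
    have "u \<bullet> (A *\<^sub>v u) / (u \<bullet> u) \<le> s"
      unfolding s_def using lower u False by (intro cInf_greatest[OF ne]) auto
    thus ?thesis
      using scalar_prod_self_pos[OF u False] by (simp add: field_simps)
  qed
  define K where "K = char_matrix A s"
  have K: "K \<in> carrier_mat n n"
    using A by (simp add: K_def)
  have form: "u \<bullet> (K *\<^sub>v u) = u \<bullet> (A *\<^sub>v u) - s * (u \<bullet> u)" if u: "u \<in> carrier_vec n" for u
  proof -
    have "K *\<^sub>v u = A *\<^sub>v u - s \<cdot>\<^sub>v u"
      using A u by (intro eq_vecI) (auto simp: K_def char_matrix_def add_scalar_prod_distrib[of _ n])
    thus ?thesis
      using A u by (simp add: scalar_prod_minus_distrib[of _ n])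
  qed
  have sym: "transpose_mat K = K"
  proof (rule eq_matI)
    fix i j assume ij: "i < dim_row K" "j < dim_col K"
    hence "A $$ (j, i) = A $$ (i, j)"
      using A K by (metis carrier_matD index_transpose_mat(1))
    thus "transpose_mat K $$ (i, j) = K $$ (i, j)"
      using A K ij by (auto simp: K_def char_matrix_def)
  qed (use K in auto)
  have "eigenvalue A s"
  proof (rule ccontr)
    assume "\<not> eigenvalue A s"
    hence "det K \<noteq> 0"
      using eigenvalue_det[OF A(1)] by (simp add: K_def)
    then obtain d where d: "d > 0" "\<And>u. u \<in> carrier_vec n \<Longrightarrow> u \<bullet> (K *\<^sub>v u) \<le> - d * (u \<bullet> u)"
      using negative_semidefinite_invertible_imp_definite[OF K sym] form s by (metis diff_le_0_iff_le)
    have "s - d \<in> R"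
      using d(2) form by (auto simp: R_def algebra_simps)
    hence "s \<le> s - d"
      unfolding s_def by (rule cInf_lower[OF _ bdd])
    thus False using d(1) by simp
  qed
  thus ?thesis
    using that s w by blast
qed

section \<open>The quadratic form of the matrix over primes\<close>

abbreviation primes_upto :: "nat \<Rightarrow> nat set" where
  "primes_upto N \<equiv> {p. prime p \<and> p \<le> N}"

text \<open>The matrix is indexed by positions in the list of primes; describing vectors by functions of
  the primes themselves turns its quadratic form into a sum over a set of primes, in which
  different \<open>N\<close> can be compared.\<close>
definition prime_vec :: "nat \<Rightarrow> (nat \<Rightarrow> real) \<Rightarrow> real vec" where
  "prime_vec N f = vec (prime_count N) (\<lambda>i. f (primes_le N ! i))"

lemma bij_betw_primes_le:
  "bij_betw ((!) (primes_le N)) {..<prime_count N} (primes_upto N)"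
proof -
  have "distinct (primes_le N)" "set (primes_le N) = primes_upto N"
    "length (primes_le N) = prime_count N"
    by (simp_all add: primes_le_def prime_count_def)
  thus ?thesis
    by (intro bij_betw_nth) auto
qed

lemma prime_vec_carrier [simp]: "prime_vec N f \<in> carrier_vec (prime_count N)"
  by (simp add: prime_vec_def)

lemma prime_vec_self: "prime_vec N f \<bullet> prime_vec N f = (\<Sum>p\<in>primes_upto N. (f p)\<^sup>2)"
proof -
  have "prime_vec N f \<bullet> prime_vec N f = (\<Sum>i<prime_count N. (f (primes_le N ! i))\<^sup>2)"
    by (simp add: scalar_prod_self_sum[of _ "prime_count N"]) (simp add: prime_vec_def)
  also have "\<dots> = (\<Sum>p\<in>primes_upto N. (f p)\<^sup>2)"
    by (rule sum.reindex_bij_betw[OF bij_betw_primes_le])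
  finally show ?thesis .
qed

lemma vec_eq_prime_vec:
  assumes "u \<in> carrier_vec (prime_count N)"
  obtains f where "u = prime_vec N f"
proof
  let ?f = "\<lambda>p. u $ inv_into {..<prime_count N} ((!) (primes_le N)) p"
  have "?f (primes_le N ! i) = u $ i" if "i < prime_count N" for i
    using that bij_betw_primes_le[of N] by (subst inv_into_f_f) (auto simp: bij_betw_def)
  thus "u = prime_vec N ?f"
    using assms by (intro eq_vecI) (auto simp: prime_vec_def)
qed

lemma W_star_carrier [simp]: "W_star N \<in> carrier_mat (prime_count N) (prime_count N)"
  by (simp add: W_star_def)

lemma transpose_W_star: "transpose_mat (W_star N) = W_star N"
  by (intro eq_matI) (auto simp: W_star_def lcm.commute)

lemma W_star_form:
  "prime_vec N f \<bullet> (W_star N *\<^sub>v prime_vec N f) =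
    (\<Sum>p\<in>primes_upto N. \<Sum>q\<in>primes_upto N. f p * \<lfloor>real N / real (lcm p q)\<rfloor> * f q)"
proof -
  let ?n = "prime_count N" and ?l = "primes_le N"
  let ?g = "\<lambda>p q. f p * \<lfloor>real N / real (lcm p q)\<rfloor> * f q"
  have "prime_vec N f \<bullet> (W_star N *\<^sub>v prime_vec N f) =
      (\<Sum>i<?n. \<Sum>j<?n. ?g (?l ! i) (?l ! j))"
    by (subst scalar_prod_mult_mat_vec_sum[of _ ?n]) (auto simp: prime_vec_def W_star_def)
  also have "\<dots> = (\<Sum>i<?n. \<Sum>q\<in>primes_upto N. ?g (?l ! i) q)"
    by (intro sum.cong refl sum.reindex_bij_betw[OF bij_betw_primes_le])
  also have "\<dots> = (\<Sum>p\<in>primes_upto N. \<Sum>q\<in>primes_upto N. ?g p q)"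
    by (rule sum.reindex_bij_betw[OF bij_betw_primes_le])
  finally show ?thesis .
qed

text \<open>Distinct primes are coprime, so \<open>1 / lcm p q\<close> differs from the rank one kernel
  \<open>1 / (p q)\<close> only on the diagonal.\<close>
lemma lcm_form_eq:
  fixes f :: "nat \<Rightarrow> real"
  assumes "finite P" "P \<subseteq> {p. prime p}"
  shows "(\<Sum>p\<in>P. \<Sum>q\<in>P. f p * (1 / real (lcm p q)) * f q) =
    (\<Sum>p\<in>P. (1 / real p - 1 / (real p)\<^sup>2) * (f p)\<^sup>2) + (\<Sum>p\<in>P. f p / real p)\<^sup>2"
proof -
  have "f p * (1 / real (lcm p q)) * f q =
      (f p / real p) * (f q / real q) +
      (if p = q then (1 / real p - 1 / (real p)\<^sup>2) * (f p)\<^sup>2 else 0)"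
    if "p \<in> P" "q \<in> P" for p q
  proof (cases "p = q")
    case True
    have "p > 0" using that assms prime_gt_0_nat by blast
    thus ?thesis using True by (simp add: field_simps power2_eq_square)
  next
    case False
    hence "coprime p q" using that assms by (auto intro: primes_coprime)
    thus ?thesis using False by (simp add: lcm_coprime)
  qed
  hence "(\<Sum>p\<in>P. \<Sum>q\<in>P. f p * (1 / real (lcm p q)) * f q) =
      (\<Sum>p\<in>P. \<Sum>q\<in>P. (f p / real p) * (f q / real q) +
      (if p = q then (1 / real p - 1 / (real p)\<^sup>2) * (f p)\<^sup>2 else 0))"
    by (intro sum.cong refl) auto
  thus ?thesis
    using assms(1) by (simp add: sum.distrib power2_eq_square sum_product)
qed

section \<open>The secular equation\<close>

text \<open>The denominators of the equation for \<open>lambda_inf\<close>.  Divided by \<open>p\<^sup>2\<close> they are the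
  distances of \<open>x\<close> from the diagonal coefficients of the limiting form (\<open>diagonal_secular\<close>).\<close>
definition secular :: "real \<Rightarrow> nat \<Rightarrow> real" where
  "secular x p = x * (real p)\<^sup>2 - real p + 1"

text \<open>The difference of the two sides is \<open>(p / 2 - 1)\<^sup>2\<close>; this is where the threshold \<open>1 / 4\<close>
  comes from, and \<open>p = 2\<close> attains it.\<close>
lemma secular_ge:
  "(x - 1 / 4) * (real p)\<^sup>2 \<le> secular x p"
proof -
  have "(real p / 2 - 1)\<^sup>2 \<ge> 0" by simp
  thus ?thesis unfolding secular_def power2_eq_square by (simp add: algebra_simps)
qed

lemma secular_pos:
  assumes "x > 1 / 4" "prime p"
  shows "secular x p > 0"
proof -
  have "(x - 1 / 4) * (real p)\<^sup>2 > 0"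
    using assms prime_gt_0_nat[of p] by simp
  thus ?thesis using secular_ge[of x p] by linarith
qed

lemma inverse_secular_le:
  assumes "a > 1 / 4" "x \<ge> a" "prime p"
  shows "1 / secular x p \<le> 1 / (a - 1 / 4) * (1 / (real p)\<^sup>2)"
proof -
  have p: "(real p)\<^sup>2 > 0" using prime_gt_0_nat[OF assms(3)] by simp
  have "(a - 1 / 4) * (real p)\<^sup>2 \<le> (x - 1 / 4) * (real p)\<^sup>2"
    using assms by (intro mult_right_mono) auto
  also have "\<dots> \<le> secular x p" by (rule secular_ge)
  finally have "1 / secular x p \<le> 1 / ((a - 1 / 4) * (real p)\<^sup>2)"
    using p assms by (intro divide_left_mono mult_pos_pos secular_pos) auto
  thus ?thesis by simp
qed

lemma prime_inverse_squares_summable: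
  "(\<lambda>p. 1 / (real p)\<^sup>2) summable_on {p :: nat. prime p}"
proof -
  have "summable (\<lambda>n. norm (1 / (real n)\<^sup>2))"
    using inverse_power_summable[of 2, where ?'a = real] by (simp add: divide_inverse)
  hence "(\<lambda>p. 1 / (real p)\<^sup>2) summable_on (UNIV :: nat set)"
    by (rule norm_summable_imp_summable_on)
  thus ?thesis by (rule summable_on_subset_banach) simp
qed

definition secular_sum :: "real \<Rightarrow> real" where
  "secular_sum x = (\<Sum>\<^sub>\<infinity>p | prime p. 1 / secular x p)"

lemma secular_has_sum:
  assumes "x > 1 / 4"
  shows "((\<lambda>p. 1 / secular x p) has_sum secular_sum x) {p. prime p}"
proof -
  have "(\<lambda>p. 1 / secular x p) summable_on {p. prime p}"
  proof (rule summable_on_comparison_test)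
    show "(\<lambda>p. 1 / (x - 1 / 4) * (1 / (real p)\<^sup>2)) summable_on {p. prime p}"
      by (intro summable_on_cmult_right prime_inverse_squares_summable)
    show "1 / secular x p \<le> 1 / (x - 1 / 4) * (1 / (real p)\<^sup>2)" if "p \<in> {p. prime p}" for p
      using that inverse_secular_le[OF assms order_refl] by blast
    show "0 \<le> 1 / secular x p" if "p \<in> {p. prime p}" for p
      using that secular_pos[OF assms, of p] by simp
  qed
  thus ?thesis
    unfolding secular_sum_def by (rule has_sum_infsum)
qed

lemma secular_sum_strict_antimono:
  assumes "1 / 4 < x" "x < y"
  shows "secular_sum y < secular_sum x"
proof -
  have less: "1 / secular y p < 1 / secular x p" if "prime p" for p
  proof -
    have "secular x p < secular y p"
      using assms prime_gt_0_nat[OF that] by (simp add: secular_def)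
    thus ?thesis using secular_pos[OF _ that] assms by (intro divide_strict_left_mono) auto
  qed
  have "y > 1 / 4"
    using assms by simp
  show ?thesis
  proof (rule has_sum_strict_mono[OF secular_has_sum[OF \<open>y > 1 / 4\<close>] secular_has_sum[OF assms(1)]])
    show "1 / secular y p \<le> 1 / secular x p" if "p \<in> {p. prime p}" for p
      using less[of p] that by simp
    show "2 \<in> {p :: nat. prime p}"
      by simp
    show "1 / secular y 2 < 1 / secular x 2"
      by (rule less) simp
  qed
qed

text \<open>Uniform convergence needs \<open>a > 1 / 4\<close>, since the term of \<open>p = 2\<close> is unbounded near \<open>1 / 4\<close>.\<close>
lemma continuous_on_secular_sum:
  assumes a: "a > 1 / 4"
  shows "continuous_on {a..} secular_sum"
proof (rule uniform_limit_theorem)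
  show "uniform_limit {a..} (\<lambda>P x. \<Sum>p\<in>P. 1 / secular x p) secular_sum
      (finite_subsets_at_top {p. prime p})"
    unfolding secular_sum_def
  proof (rule Weierstrass_m_test_general)
    show "norm (1 / secular x p) \<le> 1 / (a - 1 / 4) * (1 / (real p)\<^sup>2)"
      if "p \<in> {p. prime p}" "x \<in> {a..}" for p x
      using that a inverse_secular_le[of a x p] secular_pos[of x p] by simp
    show "(\<lambda>p. 1 / (a - 1 / 4) * (1 / (real p)\<^sup>2)) summable_on {p. prime p}"
      by (intro summable_on_cmult_right prime_inverse_squares_summable)
  qed
  have "continuous_on {a..} (\<lambda>x. \<Sum>p\<in>P. 1 / secular x p)" if "P \<subseteq> {p. prime p}" for P
  proof (intro continuous_intros ballI)
    show "secular x p \<noteq> 0" if "p \<in> P" "x \<in> {a..}" for x p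
      using that \<open>P \<subseteq> _\<close> a secular_pos[of x p] by auto
  qed (auto simp: secular_def intro!: continuous_intros)
  thus "\<forall>\<^sub>F P in finite_subsets_at_top {p. prime p}.
      continuous_on {a..} (\<lambda>x. \<Sum>p\<in>P. 1 / secular x p)"
    by (intro eventually_finite_subsets_at_top_weakI) auto
qed simp

text \<open>By the intermediate value theorem: at \<open>x = 1 / 2\<close> the prime \<open>2\<close> alone contributes \<open>1\<close>, and for large \<open>x\<close> the sum is at most
  \<open>(\<Sum> 1 / p\<^sup>2) / (x - 1 / 4)\<close>.\<close>
lemma secular_sum_solution: "\<exists>x > 1 / 4. secular_sum x = 1"
proof -
  define S where "S = (\<Sum>\<^sub>\<infinity>p | prime p. 1 / (real p)\<^sup>2)"
  have S: "((\<lambda>p :: nat. 1 / (real p)\<^sup>2) has_sum S) {p. prime p}"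
    unfolding S_def by (rule has_sum_infsum[OF prime_inverse_squares_summable])
  have S0: "S \<ge> 0"
    using S by (rule has_sum_nonneg) simp
  define b where "b = 1 / 2 + S"
  have "sum (\<lambda>p. 1 / secular (1 / 2) p) {2} \<le> secular_sum (1 / 2)"
  proof (rule finite_sum_le_has_sum[OF secular_has_sum])
    show "1 / secular (1 / 2) p \<ge> 0" if "p \<in> {p. prime p} - {2}" for p
      using that secular_pos[of "1 / 2" p] by simp
  qed auto
  hence lo: "1 \<le> secular_sum (1 / 2)"
    by (simp add: secular_def power2_eq_square)
  have b: "b > 1 / 4"
    using S0 by (simp add: b_def)
  have "secular_sum b \<le> 1 / (b - 1 / 4) * S"
  proof (rule has_sum_mono[OF secular_has_sum[OF b] has_sum_cmult_right[OF S]])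
    show "1 / secular b p \<le> 1 / (b - 1 / 4) * (1 / (real p)\<^sup>2)" if "p \<in> {p. prime p}" for p
      using that inverse_secular_le[OF b order_refl] by blast
  qed
  also have "\<dots> \<le> 1"
    using S0 by (simp add: b_def field_simps)
  finally have hi: "secular_sum b \<le> 1" .
  have "continuous_on {1 / 2..b} secular_sum"
    using continuous_on_subset[OF continuous_on_secular_sum[of "1 / 2"]] by auto
  hence "\<exists>x. 1 / 2 \<le> x \<and> x \<le> b \<and> secular_sum x = 1"
    using lo hi S0 by (intro IVT2') (auto simp: b_def)
  thus ?thesis by force
qed

lemma lambda_inf_properties:
  shows lambda_inf_gt: "lambda_inf > 1 / 4"
    and lambda_inf_has_sum: "((\<lambda>p. 1 / secular lambda_inf p) has_sum 1) {p. prime p}"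
proof -
  obtain x where x: "x > 1 / 4" "secular_sum x = 1"
    using secular_sum_solution by blast
  have "lambda_inf = x"
    unfolding lambda_inf_def
  proof (rule the_equality)
    show "1 / 4 < x \<and> ((\<lambda>p. 1 / (x * (real p)\<^sup>2 - real p + 1)) has_sum 1) {p. prime p}"
      using x secular_has_sum[of x] by (simp add: secular_def)
  next
    fix y assume y: "1 / 4 < y \<and> ((\<lambda>p. 1 / (y * (real p)\<^sup>2 - real p + 1)) has_sum 1) {p. prime p}"
    hence "secular_sum y = 1"
      using secular_has_sum[of y] has_sum_unique unfolding secular_def by blast
    thus "y = x"
      using x y secular_sum_strict_antimono[of x y] secular_sum_strict_antimono[of y x]
      by (cases x y rule: linorder_cases) auto
  qed
  thus "lambda_inf > 1 / 4" "((\<lambda>p. 1 / secular lambda_inf p) has_sum 1) {p. prime p}"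
    using x secular_has_sum[of x] by simp_all
qed

section \<open>Upper and lower bounds for the largest eigenvalue\<close>

lemma diagonal_secular:
  assumes "prime p"
  shows "secular x p / (real p)\<^sup>2 * z = x * z - (1 / real p - 1 / (real p)\<^sup>2) * z"
proof -
  have "secular x p / (real p)\<^sup>2 = x - (1 / real p - 1 / (real p)\<^sup>2)"
    using prime_gt_0_nat[OF assms] by (simp add: secular_def field_simps power2_eq_square)
  thus ?thesis by (simp only: left_diff_distrib)
qed

text \<open>By the Cauchy--Schwarz inequality with weights \<open>secular x p / p\<^sup>2\<close>, the rank one part
  is dominated by what the diagonal part leaves free below \<open>x\<close>, exactly because the
  reciprocals of \<open>secular x p\<close> sum to at most \<open>1\<close>.\<close>
lemma lcm_form_le:
  fixes f :: "nat \<Rightarrow> real"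
  assumes P: "finite P" "P \<subseteq> {p. prime p}" and x: "x > 1 / 4"
    and sum_le: "(\<Sum>p\<in>P. 1 / secular x p) \<le> 1"
  shows "(\<Sum>p\<in>P. \<Sum>q\<in>P. f p * (1 / real (lcm p q)) * f q) \<le> x * (\<Sum>p\<in>P. (f p)\<^sup>2)"
proof -
  have pos: "secular x p > 0" "real p > 0" if "p \<in> P" for p
    using that P x secular_pos prime_gt_0_nat by auto
  have "(\<Sum>p\<in>P. f p / real p)\<^sup>2 =
      (\<Sum>p\<in>P. (f p * sqrt (secular x p) / real p) * (1 / sqrt (secular x p)))\<^sup>2"
    using pos by (intro arg_cong[where f = "\<lambda>z. z\<^sup>2"] sum.cong) (auto simp: field_simps less_imp_neq[symmetric])
  also have "\<dots> \<le> (\<Sum>p\<in>P. (f p * sqrt (secular x p) / real p)\<^sup>2) *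
      (\<Sum>p\<in>P. (1 / sqrt (secular x p))\<^sup>2)"
    by (rule Cauchy_Schwarz_ineq_sum)
  also have "(\<Sum>p\<in>P. (1 / sqrt (secular x p))\<^sup>2) = (\<Sum>p\<in>P. 1 / secular x p)"
    using pos by (intro sum.cong refl) (simp add: power_divide less_imp_le)
  also have "(\<Sum>p\<in>P. (f p * sqrt (secular x p) / real p)\<^sup>2) =
      (\<Sum>p\<in>P. secular x p / (real p)\<^sup>2 * (f p)\<^sup>2)"
    using pos by (intro sum.cong refl) (simp add: power_divide power_mult_distrib less_imp_le)
  also have "\<dots> * (\<Sum>p\<in>P. 1 / secular x p) \<le> (\<Sum>p\<in>P. secular x p / (real p)\<^sup>2 * (f p)\<^sup>2) * 1"
    using pos by (intro mult_left_mono[OF sum_le] sum_nonneg) (simp add: less_imp_le)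
  also have "\<dots> = x * (\<Sum>p\<in>P. (f p)\<^sup>2) - (\<Sum>p\<in>P. (1 / real p - 1 / (real p)\<^sup>2) * (f p)\<^sup>2)"
    unfolding mult_1_right sum_distrib_left sum_subtractf[symmetric]
    using P by (intro sum.cong refl diagonal_secular) auto
  finally show ?thesis
    unfolding lcm_form_eq[OF P] by simp
qed

lemma eigenvalue_W_star_le:
  assumes ev: "eigenvalue (W_star N) e"
  shows "e \<le> real N * lambda_inf"
proof -
  let ?P = "primes_upto N"
  obtain u where u: "u \<in> carrier_vec (prime_count N)" "u \<noteq> 0\<^sub>v (prime_count N)"
    "W_star N *\<^sub>v u = e \<cdot>\<^sub>v u"
    using ev W_star_carrier[of N] unfolding eigenvalue_def eigenvector_def by auto
  obtain f where f: "u = prime_vec N f"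
    using vec_eq_prime_vec[OF u(1)] by blast
  have "e * (u \<bullet> u) = u \<bullet> (W_star N *\<^sub>v u)"
    using u by simp
  also have "\<dots> = (\<Sum>p\<in>?P. \<Sum>q\<in>?P. f p * \<lfloor>real N / real (lcm p q)\<rfloor> * f q)"
    unfolding f by (rule W_star_form)
  \<comment> \<open>Passing to absolute values makes rounding down the entries monotone.\<close>
  also have "\<dots> \<le> (\<Sum>p\<in>?P. \<Sum>q\<in>?P. real N * (\<bar>f p\<bar> * (1 / real (lcm p q)) * \<bar>f q\<bar>))"
  proof (intro sum_mono)
    fix p q
    have "f p * \<lfloor>real N / real (lcm p q)\<rfloor> * f q \<le> \<bar>f p\<bar> * \<bar>f q\<bar> * \<lfloor>real N / real (lcm p q)\<rfloor>"
      by (rule order_trans[OF abs_ge_self]) (simp add: abs_mult mult_ac)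
    also have "\<dots> \<le> \<bar>f p\<bar> * \<bar>f q\<bar> * (real N / real (lcm p q))"
      by (intro mult_left_mono) auto
    finally show "f p * \<lfloor>real N / real (lcm p q)\<rfloor> * f q \<le>
        real N * (\<bar>f p\<bar> * (1 / real (lcm p q)) * \<bar>f q\<bar>)"
      by (simp add: mult_ac)
  qed
  also have "\<dots> = real N * (\<Sum>p\<in>?P. \<Sum>q\<in>?P. \<bar>f p\<bar> * (1 / real (lcm p q)) * \<bar>f q\<bar>)"
    by (simp only: sum_distrib_left)
  also have "\<dots> \<le> real N * (lambda_inf * (\<Sum>p\<in>?P. \<bar>f p\<bar>\<^sup>2))"
  proof (intro mult_left_mono lcm_form_le lambda_inf_gt)
    show "(\<Sum>p\<in>?P. 1 / secular lambda_inf p) \<le> 1"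
      using lambda_inf_gt by (intro finite_sum_le_has_sum[OF lambda_inf_has_sum])
        (auto intro: less_imp_le[OF secular_pos])
  qed auto
  also have "\<dots> = real N * lambda_inf * (u \<bullet> u)"
    by (simp add: f prime_vec_self)
  finally show ?thesis
    using scalar_prod_self_pos[OF u(1,2)] by simp
qed

lemma lambda_max_ge:
  assumes "A \<in> carrier_mat n n" "eigenvalue A e"
  shows "e \<le> lambda_max A"
  unfolding lambda_max_def using assms card_finite_spectrum(1)[OF assms(1)]
  by (intro Max_ge) (auto simp: spectrum_def)

lemma eigenvalue_lambda_max:
  fixes A :: "real mat"
  assumes A: "A \<in> carrier_mat n n" "transpose_mat A = A" and "n > 0"
  shows "eigenvalue A (lambda_max A)"
proof -
  have "unit_vec n 0 \<noteq> (0\<^sub>v n :: real vec)"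
    using \<open>n > 0\<close> by (metis index_unit_vec(2) index_zero_vec(1) zero_neq_one)
  then obtain e where "eigenvalue A e"
    using symmetric_eigenvalue_ge_rayleigh[OF A, of "unit_vec n 0"] by auto
  hence "lambda_max A \<in> spectrum A"
    unfolding lambda_max_def using card_finite_spectrum(1)[OF A(1)]
    by (intro Max_in) (auto simp: spectrum_def)
  thus ?thesis by (simp add: spectrum_def)
qed

lemma prime_count_pos: "N \<ge> 2 \<Longrightarrow> prime_count N > 0"
  unfolding prime_count_def card_gt_0_iff using two_is_prime_nat by (auto intro!: exI[of _ 2])

lemma lambda_max_W_star_le:
  assumes "N \<ge> 2"
  shows "lambda_max (W_star N) / real N \<le> lambda_inf"
  using eigenvalue_W_star_le[OF eigenvalue_lambda_max[OF W_star_carrier transpose_W_star prime_count_pos[OF assms]]]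
    assms by (simp add: field_simps)

text \<open>Extending \<open>f\<close> by zero outside \<open>F\<close> gives a test vector whose Rayleigh quotient is a sum over
  an index set independent of \<open>N\<close>, so that its limit can be taken term by term.\<close>
lemma lambda_max_W_star_ge:
  fixes f :: "nat \<Rightarrow> real"
  assumes F: "F \<subseteq> primes_upto N" and pos: "(\<Sum>p\<in>F. (f p)\<^sup>2) > 0"
  shows "(\<Sum>p\<in>F. \<Sum>q\<in>F. f p * (\<lfloor>real N / real (lcm p q)\<rfloor> / real N) * f q) / (\<Sum>p\<in>F. (f p)\<^sup>2)
    \<le> lambda_max (W_star N) / real N"
proof -
  define g where "g p = (if p \<in> F then f p else 0)" for p
  define u where "u = prime_vec N g"
  have restrict: "(\<Sum>p\<in>primes_upto N. if p \<in> F then h p else 0) = sum h F" for h :: "nat \<Rightarrow> real"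
    using F by (simp add: sum.If_cases Int_absorb1 flip: sum.inter_restrict)
  have uu: "u \<bullet> u = (\<Sum>p\<in>F. (f p)\<^sup>2)"
    unfolding u_def prime_vec_self restrict[symmetric] by (intro sum.cong) (auto simp: g_def)
  have "u \<bullet> (W_star N *\<^sub>v u) = (\<Sum>p\<in>primes_upto N. if p \<in> F then
      (\<Sum>q\<in>primes_upto N. if q \<in> F then f p * \<lfloor>real N / real (lcm p q)\<rfloor> * f q else 0) else 0)"
    unfolding u_def W_star_form by (intro sum.cong refl) (auto simp: g_def intro!: sum.cong)
  hence uWu: "u \<bullet> (W_star N *\<^sub>v u) = (\<Sum>p\<in>F. \<Sum>q\<in>F. f p * \<lfloor>real N / real (lcm p q)\<rfloor> * f q)"
    by (simp only: restrict)
  have u: "u \<in> carrier_vec (prime_count N)" "u \<noteq> 0\<^sub>v (prime_count N)"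
    using uu pos by (auto simp: u_def)
  obtain e where e: "eigenvalue (W_star N) e" "u \<bullet> (W_star N *\<^sub>v u) \<le> e * (u \<bullet> u)"
    using symmetric_eigenvalue_ge_rayleigh[OF W_star_carrier transpose_W_star u] by blast
  have "u \<bullet> (W_star N *\<^sub>v u) / (u \<bullet> u) \<le> e"
    using e(2) uu pos by (simp add: field_simps)
  also have "e \<le> lambda_max (W_star N)"
    by (rule lambda_max_ge[OF W_star_carrier e(1)])
  finally have "u \<bullet> (W_star N *\<^sub>v u) / (u \<bullet> u) / real N \<le> lambda_max (W_star N) / real N"
    by (rule divide_right_mono) simp
  also have "u \<bullet> (W_star N *\<^sub>v u) / (u \<bullet> u) / real N =
      (\<Sum>p\<in>F. \<Sum>q\<in>F. f p * (\<lfloor>real N / real (lcm p q)\<rfloor> / real N) * f q) / (\<Sum>p\<in>F. (f p)\<^sup>2)"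
    unfolding uu uWu by (simp add: sum_divide_distrib mult_ac)
  finally show ?thesis .
qed

lemma floor_quotient_tendsto:
  "(\<lambda>N. \<lfloor>real N / d\<rfloor> / real N) \<longlonglongrightarrow> 1 / d"
proof (rule tendsto_sandwich)
  have ev: "\<forall>\<^sub>F N :: nat in sequentially. N > 0"
    by (rule eventually_gt_at_top)
  show "\<forall>\<^sub>F N in sequentially. 1 / d - 1 / real N \<le> \<lfloor>real N / d\<rfloor> / real N"
    using ev
  proof eventually_elim
    case (elim N)
    have "(real N / d - 1) / real N \<le> \<lfloor>real N / d\<rfloor> / real N"
      by (intro divide_right_mono) linarith+
    thus ?case using elim by (simp add: diff_divide_distrib)
  qed
  show "\<forall>\<^sub>F N in sequentially. \<lfloor>real N / d\<rfloor> / real N \<le> 1 / d"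
    using ev
  proof eventually_elim
    case (elim N)
    have "\<lfloor>real N / d\<rfloor> / real N \<le> real N / d / real N"
      by (intro divide_right_mono) auto
    thus ?case using elim by simp
  qed
  show "(\<lambda>N. 1 / d - 1 / real N) \<longlonglongrightarrow> 1 / d"
    using tendsto_diff[OF tendsto_const lim_1_over_n, of "1 / d"] by simp
qed simp

text \<open>For this \<open>f\<close> both \<open>\<Sum> f p / p\<close> and the distance of the diagonal form from \<open>x\<close> times the
  squared norm equal \<open>S\<close>.  The defect \<open>S - S\<^sup>2\<close> tends to \<open>0\<close> when \<open>F\<close> exhausts the primes
  and the full sum is \<open>1\<close>.\<close>
lemma lcm_form_truncated_eigenvector:
  fixes F :: "nat set"
  assumes F: "finite F" "F \<subseteq> {p. prime p}" and x: "x > 1 / 4"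
  defines "f \<equiv> \<lambda>p. real p / secular x p"
  defines "S \<equiv> \<Sum>p\<in>F. 1 / secular x p"
  shows "(\<Sum>p\<in>F. \<Sum>q\<in>F. f p * (1 / real (lcm p q)) * f q) = x * (\<Sum>p\<in>F. (f p)\<^sup>2) - S * (1 - S)"
proof -
  have pos: "secular x p > 0" "real p > 0" if "p \<in> F" for p
    using that F x secular_pos prime_gt_0_nat by auto
  have "S = (\<Sum>p\<in>F. secular x p / (real p)\<^sup>2 * (f p)\<^sup>2)"
    unfolding S_def f_def using pos
    by (intro sum.cong refl) (auto simp: power2_eq_square less_imp_neq[symmetric])
  also have "\<dots> = x * (\<Sum>p\<in>F. (f p)\<^sup>2) - (\<Sum>p\<in>F. (1 / real p - 1 / (real p)\<^sup>2) * (f p)\<^sup>2)"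
    unfolding sum_distrib_left sum_subtractf[symmetric]
    using F by (intro sum.cong refl diagonal_secular) auto
  finally have diag: "(\<Sum>p\<in>F. (1 / real p - 1 / (real p)\<^sup>2) * (f p)\<^sup>2) = x * (\<Sum>p\<in>F. (f p)\<^sup>2) - S"
    by simp
  have "(\<Sum>p\<in>F. f p / real p) = S"
    unfolding S_def f_def using pos by (intro sum.cong refl) (auto simp: less_imp_neq[symmetric])
  thus ?thesis
    unfolding lcm_form_eq[OF F] diag by (simp add: power2_eq_square algebra_simps)
qed

lemma eventually_lambda_max_W_star_gt:
  assumes "a < lambda_inf"
  shows "\<forall>\<^sub>F N in sequentially. a < lambda_max (W_star N) / real N"
proof -
  define f where "f p = real p / secular lambda_inf p" for p
  define c where "c = (f 2)\<^sup>2"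
  have c: "c > 0"
    using secular_pos[OF lambda_inf_gt two_is_prime_nat] by (simp add: c_def f_def)
  define d where "d = (lambda_inf - a) * c"
  have d: "d > 0"
    using assms c by (simp add: d_def)
  have nonneg: "1 / secular lambda_inf p \<ge> 0" if "prime p" for p
    using secular_pos[OF lambda_inf_gt that] by simp
  have "\<forall>\<^sub>F P in finite_subsets_at_top {p. prime p}. 1 - d < (\<Sum>p\<in>P. 1 / secular lambda_inf p)"
    using lambda_inf_has_sum d unfolding has_sum_def by (intro order_tendstoD(1)) auto
  then obtain F0 where F0: "finite F0" "F0 \<subseteq> {p. prime p}"
    "\<forall>P. finite P \<and> F0 \<subseteq> P \<and> P \<subseteq> {p. prime p} \<longrightarrow> 1 - d < (\<Sum>p\<in>P. 1 / secular lambda_inf p)"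
    unfolding eventually_finite_subsets_at_top by (elim exE conjE)
  \<comment> \<open>The prime \<open>2\<close> keeps the norm of the test vector bounded away from \<open>0\<close>.\<close>
  define F where "F = insert 2 F0"
  define S where "S = (\<Sum>p\<in>F. 1 / secular lambda_inf p)"
  define T where "T = (\<Sum>p\<in>F. (f p)\<^sup>2)"
  have F: "finite F" "F \<subseteq> {p. prime p}"
    using F0 by (auto simp: F_def)
  have "F0 \<subseteq> F"
    by (auto simp: F_def)
  hence S1: "1 - d < S"
    unfolding S_def using F0(3) F by simp
  have S2: "0 \<le> S"
    unfolding S_def using F nonneg by (intro sum_nonneg) blast
  have S3: "S \<le> 1"
    unfolding S_def using F nonneg by (intro finite_sum_le_has_sum[OF lambda_inf_has_sum]) blast+
  have T: "c \<le> T"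
    unfolding c_def T_def using F by (intro member_le_sum) (auto simp: F_def)
  have "S * (1 - S) \<le> 1 - S"
    using S2 S3 by (intro mult_left_le_one_le) auto
  also have "\<dots> < d"
    using S1 by simp
  also have "d \<le> (lambda_inf - a) * T"
    unfolding d_def using T assms by (intro mult_left_mono) auto
  finally have "a * T < lambda_inf * T - S * (1 - S)"
    by (simp add: algebra_simps)
  hence "a < (\<Sum>p\<in>F. \<Sum>q\<in>F. f p * (1 / real (lcm p q)) * f q) / T"
    using lcm_form_truncated_eigenvector[OF F lambda_inf_gt] T c
    by (simp add: f_def S_def T_def field_simps)
  moreover have "(\<lambda>N. (\<Sum>p\<in>F. \<Sum>q\<in>F. f p * (\<lfloor>real N / real (lcm p q)\<rfloor> / real N) * f q) / T)
      \<longlonglongrightarrow> (\<Sum>p\<in>F. \<Sum>q\<in>F. f p * (1 / real (lcm p q)) * f q) / T"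
    using T c by (intro tendsto_intros floor_quotient_tendsto) auto
  ultimately have "\<forall>\<^sub>F N in sequentially.
      a < (\<Sum>p\<in>F. \<Sum>q\<in>F. f p * (\<lfloor>real N / real (lcm p q)\<rfloor> / real N) * f q) / T"
    by (rule order_tendstoD(1)[rotated])
  moreover have "\<forall>\<^sub>F N in sequentially. Max F \<le> N"
    by (rule eventually_ge_at_top)
  ultimately show ?thesis
  proof eventually_elim
    case (elim N)
    have "F \<subseteq> primes_upto N"
      using F elim(2) by (auto intro: order_trans[OF Max_ge])
    thus ?case
      using lambda_max_W_star_ge[of F N f] elim(1) T c by (simp add: T_def)
  qed
qed

theorem theorem5p8:
  "(\<lambda>N. lambda_max (W_star N) / real N) \<longlonglongrightarrow> lambda_inf"
proof (rule order_tendstoI)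
  show "\<forall>\<^sub>F N in sequentially. a < lambda_max (W_star N) / real N" if "a < lambda_inf" for a
    using that by (rule eventually_lambda_max_W_star_gt)
  show "\<forall>\<^sub>F N in sequentially. lambda_max (W_star N) / real N < a" if "lambda_inf < a" for a
    using eventually_ge_at_top[of 2]
  proof eventually_elim
    case (elim N)
    thus ?case using lambda_max_W_star_le[OF elim] that by linarith
  qed
qed

end
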